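(* Let $m\le n$ be positive integers. If $m,n\ge 4$, or if $m\ge 3$ and $n\ge 5$, then the complete bipartite graph $K_{m,n}$ is not a weak unit rectangle visibility graph.
   Context: A finite simple graph $G$ is a weak unit rectangle visibility graph if its vertices $v$ can be represented by closed unit squares $S_v$ in the plane with sides parallel to the coordinate axes and with pairwise disjoint interiors (squares may touch along their boundaries), in such a way that whenever two vertices $v,w$ are adjacent there is an unobstructed non-degenerate (positive width) horizontal or vertical band of visibility joining $S_v$ and $S_w$. Here a horizontal band of visibility joining $S_v$ and $S_w$ is given by an open interval $I$ of positive length such that for every $y_0\in I$ the line $y=y_0$ meets the interiors of both $S_v$ and $S_w$, and the part of this line between $S_v$ and $S_w$ (possibly a single point if the squares touch) meets the interior of no other square of the representation; vertical bands are defined analogously with the roles of $x$ and $y$ exchanged. *)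

theory Defs
  imports "HOL-Analysis.Analysis" "Graph_Theory.Graph_Theory"
begin

definition unit_square :: "(real \<times> real) set \<Rightarrow> bool" where
  "unit_square A \<longleftrightarrow> (\<exists>a b. A = {a..a + 1} \<times> {b..b + 1})"

text \<open>
  An axis-parallel line is given by its parametrization \<open>l :: real \<Rightarrow> real \<times> real\<close> by the free
  coordinate. If \<open>l\<close> meets \<open>A\<close> and \<open>B\<close> in the parameter intervals \<open>{a..a'}\<close> and \<open>{b..b'}\<close> with
  \<open>a < a'\<close>, \<open>b < b'\<close> and \<open>a' \<le> b\<close>, the part of \<open>l\<close> between \<open>A\<close> and \<open>B\<close> is the closed segment
  \<open>l ` {a'..b}\<close>, which is a single point if \<open>a' = b\<close>.
  The two disjuncts are the two possible orders of \<open>A\<close> and \<open>B\<close> along \<open>l\<close>.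
\<close>

definition line_between ::
  "(real \<Rightarrow> real \<times> real) \<Rightarrow> (real \<times> real) set \<Rightarrow> (real \<times> real) set \<Rightarrow> (real \<times> real) set" where
  "line_between l A B = l `
     {t. (\<forall>a b. l a \<in> A \<and> l b \<in> B \<longrightarrow> a \<le> t \<and> t \<le> b) \<or>
         (\<forall>a b. l a \<in> A \<and> l b \<in> B \<longrightarrow> b \<le> t \<and> t \<le> a)}"

definition visible_along ::
  "(real \<Rightarrow> real \<times> real) \<Rightarrow> 'a set \<Rightarrow> ('a \<Rightarrow> (real \<times> real) set) \<Rightarrow> 'a \<Rightarrow> 'a \<Rightarrow> bool" where
  "visible_along l V S v w \<longleftrightarrow>
     range l \<inter> interior (S v) \<noteq> {} \<and> range l \<inter> interior (S w) \<noteq> {} \<and>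
     (\<forall>u\<in>V - {v, w}. line_between l (S v) (S w) \<inter> interior (S u) = {})"

definition horizontal_band :: "'a set \<Rightarrow> ('a \<Rightarrow> (real \<times> real) set) \<Rightarrow> 'a \<Rightarrow> 'a \<Rightarrow> bool" where
  "horizontal_band V S v w \<longleftrightarrow>
     (\<exists>c d. c < d \<and> (\<forall>y\<in>{c<..<d}. visible_along (\<lambda>x. (x, y)) V S v w))"

definition vertical_band :: "'a set \<Rightarrow> ('a \<Rightarrow> (real \<times> real) set) \<Rightarrow> 'a \<Rightarrow> 'a \<Rightarrow> bool" where
  "vertical_band V S v w \<longleftrightarrow>
     (\<exists>c d. c < d \<and> (\<forall>x\<in>{c<..<d}. visible_along (\<lambda>y. (x, y)) V S v w))"

text \<open>
  ``Weak'' means that bands are required for adjacent vertices, but not excluded for others.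
\<close>

definition weak_unit_rect_visibility_rep ::
  "('a, 'b) pre_digraph \<Rightarrow> ('a \<Rightarrow> (real \<times> real) set) \<Rightarrow> bool" where
  "weak_unit_rect_visibility_rep G S \<longleftrightarrow>
     (\<forall>v\<in>verts G. unit_square (S v)) \<and>
     (\<forall>v\<in>verts G. \<forall>w\<in>verts G. v \<noteq> w \<longrightarrow> interior (S v) \<inter> interior (S w) = {}) \<and>
     (\<forall>v w. v \<rightarrow>\<^bsub>G\<^esub> w \<longrightarrow> horizontal_band (verts G) S v w \<or> vertical_band (verts G) S v w)"

definition weak_unit_rect_visibility_graph :: "('a, 'b) pre_digraph \<Rightarrow> bool" where
  "weak_unit_rect_visibility_graph G \<longleftrightarrow>
     graph G \<and> (\<exists>S. weak_unit_rect_visibility_rep G S)"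

end

theory Submission
  imports Defs
begin

text \<open>
  The lower left corners of the squares, together with one line of sight for each edge, turn a
  representation into a system of disjunctions of linear inequalities. For \<open>K\<^bsub>3,4\<^esub>\<close> this system
  forces the leftmost square to lie in the part of size 4. In \<open>K\<^bsub>4,4\<^esub>\<close> this puts the leftmost
  square into both parts. In \<open>K\<^bsub>3,5\<^esub>\<close>, deleting the leftmost square of the part of size 5 shows that
  the first two squares of this part precede the whole part of size 3. The third one then has to
  follow the middle square of the part of size 3, as no \<open>K\<^bsub>3,3\<^esub>\<close> admits the other order. Reflecting
  the plane, the third one also has to precede it.
\<close>

section \<open>Systems of inequalities and their symmetries\<close>

definition apart :: "('a \<Rightarrow> real) \<Rightarrow> ('a \<Rightarrow> real) \<Rightarrow> 'a \<Rightarrow> 'a \<Rightarrow> bool" where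
  "apart x y i j \<longleftrightarrow> x i + 1 \<le> x j \<or> x j + 1 \<le> x i \<or> y i + 1 \<le> y j \<or> y j + 1 \<le> y i"

text \<open>
  The square of a vertex \<open>v\<close> has lower left corner \<open>(x v, y v)\<close>, and \<open>p\<close> is the first coordinate
  of a vertical line. Excluding only \<open>k\<close> strictly between \<open>u\<close> and \<open>w\<close> makes the conditions for
  \<open>k = u\<close> and \<open>k = w\<close> trivial; for squares with disjoint interiors nothing is lost.
\<close>

definition line_of_sight ::
  "('a \<Rightarrow> real) \<Rightarrow> ('a \<Rightarrow> real) \<Rightarrow> 'a set \<Rightarrow> 'a \<Rightarrow> 'a \<Rightarrow> real \<Rightarrow> bool" where
  "line_of_sight x y P u w p \<longleftrightarrow>
     x u < p \<and> p < x u + 1 \<and> x w < p \<and> p < x w + 1 \<and>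
     (\<forall>k\<in>P. p \<le> x k \<or> x k + 1 \<le> p \<or> y k \<le> y u \<and> y k \<le> y w \<or> y u \<le> y k \<and> y w \<le> y k)"

definition bipartite_rep ::
  "('a \<Rightarrow> real) \<Rightarrow> ('a \<Rightarrow> real) \<Rightarrow> 'a set \<Rightarrow> 'a set \<Rightarrow> bool" where
  "bipartite_rep x y U V \<longleftrightarrow> U \<inter> V = {} \<and> pairwise (apart x y) (U \<union> V) \<and>
     (\<forall>u\<in>U. \<forall>w\<in>V. \<exists>p. line_of_sight x y (U \<union> V) u w p \<or> line_of_sight y x (U \<union> V) u w p)"

text \<open>Deleting squares can only remove obstructions, so every line of sight between remaining
  squares survives.\<close>

lemma bipartite_rep_mono:
  assumes "bipartite_rep x y U V" and "U' \<subseteq> U" and "V' \<subseteq> V"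
  shows "bipartite_rep x y U' V'"
proof -
  have sub: "U' \<union> V' \<subseteq> U \<union> V"
    using assms by blast
  have "line_of_sight x' y' (U' \<union> V') u w p" if "line_of_sight x' y' (U \<union> V) u w p" for x' y' u w p
    using that sub unfolding line_of_sight_def by blast
  then show ?thesis
    using assms pairwise_subset[OF _ sub] unfolding bipartite_rep_def
    by (meson disjoint_iff subsetD)
qed

lemma line_of_sight_commute: "line_of_sight x y P u w p \<longleftrightarrow> line_of_sight x y P w u p"
  unfolding line_of_sight_def by blast

lemma bipartite_rep_commute: "bipartite_rep x y U V \<Longrightarrow> bipartite_rep x y V U"
  unfolding bipartite_rep_def by (metis Un_commute Int_commute line_of_sight_commute)

text \<open>Reflection turns \<open>{x v..x v + 1}\<close> into \<open>{- x v - 1..- x v}\<close>.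
  Translating everything by 1 makes \<open>- x v\<close> the left end again, which is why the line
  at \<open>p\<close> moves to \<open>1 - p\<close>.\<close>

lemma bipartite_rep_reflect:
  assumes "bipartite_rep x y U V"
  shows "bipartite_rep (\<lambda>v. - x v) y U V"
proof -
  have "apart (\<lambda>v. - x v) y i j" if "apart x y i j" for i j
    using that unfolding apart_def by linarith
  moreover have "line_of_sight (\<lambda>v. - x v) y P u w (1 - p)" if "line_of_sight x y P u w p" for P u w p
    using that unfolding line_of_sight_def by (auto 4 4)
  moreover have "line_of_sight y (\<lambda>v. - x v) P u w p" if "line_of_sight y x P u w p" for P u w p
    using that unfolding line_of_sight_def by auto
  ultimately show ?thesis
    using assms unfolding bipartite_rep_def pairwise_def by meson
qed

lemma bipartite_rep_swap: "bipartite_rep x y U V \<Longrightarrow> bipartite_rep y x U V"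
  unfolding bipartite_rep_def pairwise_def apart_def by meson

section \<open>Finite instances over explicit lists\<close>

lemma pairwise_imp_sorted_wrt:
  "distinct xs \<Longrightarrow> pairwise R (set xs) \<Longrightarrow> sorted_wrt R xs"
  by (induction xs) (auto simp: pairwise_insert)

lemma ex_sorted_map_enumeration:
  fixes f :: "'a \<Rightarrow> 'b :: linorder"
  assumes "finite A"
  shows "\<exists>xs. set xs = A \<and> distinct xs \<and> sorted (map f xs)"
proof -
  obtain xs where "set xs = A" "distinct xs"
    using finite_distinct_list[OF assms] by blast
  then show ?thesis
    by (intro exI[of _ "sort_key f xs"]) auto
qed

text \<open>Prepares concrete instances for arithmetic: the lines are Skolemized into one function
  \<open>p\<close> of the edge, and \<open>sorted_wrt\<close> yields each unordered pair of squares
  once, enough since \<open>apart\<close> is symmetric.\<close>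

lemma bipartite_rep_witness:
  assumes "bipartite_rep x y (set us) (set vs)" and "distinct us" and "distinct vs"
  obtains p where "sorted_wrt (apart x y) (us @ vs)"
    and "\<forall>u\<in>set us. \<forall>w\<in>set vs.
      line_of_sight x y (set (us @ vs)) u w (p u w) \<or> line_of_sight y x (set (us @ vs)) u w (p u w)"
proof -
  have "\<forall>u. \<exists>q. \<forall>w. u \<in> set us \<longrightarrow> w \<in> set vs \<longrightarrow>
      line_of_sight x y (set (us @ vs)) u w (q w) \<or> line_of_sight y x (set (us @ vs)) u w (q w)"
    using assms unfolding bipartite_rep_def set_append by meson
  then obtain p where "\<forall>u w. u \<in> set us \<longrightarrow> w \<in> set vs \<longrightarrow>
      line_of_sight x y (set (us @ vs)) u w (p u w) \<or> line_of_sight y x (set (us @ vs)) u w (p u w)"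
    by metis
  moreover have "sorted_wrt (apart x y) (us @ vs)"
    using assms by (intro pairwise_imp_sorted_wrt) (auto simp: bipartite_rep_def)
  ultimately show ?thesis
    using that by blast
qed

section \<open>Two configurations refuted by linear arithmetic\<close>

text \<open>For six explicit vertices, the 15 separations and 9 lines of sight unfold to a
  quantifier-free problem in linear real arithmetic, whose case distinction is left to the SMT
  solver.\<close>

lemma no_K33_first_two_before:
  assumes "bipartite_rep x y (set [a, b, c]) (set [d, e, f])"
    and "distinct [a, b, c]" and "distinct [d, e, f]"
    and ord: "x a \<le> x b" "x b \<le> x c" "x d \<le> x e" "x e \<le> x f" "x e \<le> x a" "x f \<le> x b"
  shows False
proof -
  obtain p where "sorted_wrt (apart x y) ([a, b, c] @ [d, e, f])"
    and "\<forall>u\<in>set [a, b, c]. \<forall>w\<in>set [d, e, f].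
      line_of_sight x y (set ([a, b, c] @ [d, e, f])) u w (p u w) \<or>
      line_of_sight y x (set ([a, b, c] @ [d, e, f])) u w (p u w)"
    using bipartite_rep_witness[OF assms(1-3)] by blast
  then show False
    using ord supply [[smt_timeout = 600]]
    by (simp only: apart_def line_of_sight_def append.simps list.set sorted_wrt.simps
      ball_simps simp_thms order_refl)
      (smt (z3))
qed

text \<open>Fixing the vertical order of \<open>a\<close> and \<open>d\<close> halves the case
  distinction; a vertical reflection supplies the other half.\<close>

lemma no_K34_leftmost_below:
  assumes "bipartite_rep x y (set [a, b, c]) (set [d, e, f, g])"
    and "distinct [a, b, c]" and "distinct [d, e, f, g]"
    and ord: "x a \<le> x b" "x b \<le> x c" "x a \<le> x d" "x d \<le> x e" "x e \<le> x f" "x f \<le> x g" "y a \<le> y d"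
  shows False
proof -
  obtain p where "sorted_wrt (apart x y) ([a, b, c] @ [d, e, f, g])"
    and "\<forall>u\<in>set [a, b, c]. \<forall>w\<in>set [d, e, f, g].
      line_of_sight x y (set ([a, b, c] @ [d, e, f, g])) u w (p u w) \<or>
      line_of_sight y x (set ([a, b, c] @ [d, e, f, g])) u w (p u w)"
    using bipartite_rep_witness[OF assms(1-3)] by blast
  then show False
    using ord supply [[smt_timeout = 600]]
    by (simp only: apart_def line_of_sight_def append.simps list.set sorted_wrt.simps
      ball_simps simp_thms order_refl)
      (smt (z3))
qed

section \<open>The leftmost square, and the two forbidden graphs\<close>

lemma K34_leftmost:
  assumes rep: "bipartite_rep x y U V" and "card U = 3" and "card V = 4"
  shows "\<exists>v\<in>V. \<forall>u\<in>U. x v < x u"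
proof (rule ccontr)
  assume contra: "\<not> ?thesis"
  have "finite U" "finite V"
    using assms by (simp_all add: card_ge_0_finite)
  then obtain us vs where us: "set us = U" "distinct us" "sorted (map x us)"
    and vs: "set vs = V" "distinct vs" "sorted (map x vs)"
    using ex_sorted_map_enumeration by metis
  have "length us = 3" "length vs = 4"
    using assms us vs distinct_card by metis+
  then obtain a b c d e f g where eqs: "us = [a, b, c]" "vs = [d, e, f, g]"
    by (auto simp: numeral_eq_Suc length_Suc_conv)
  obtain u where "u \<in> U" "x u \<le> x d"
    using contra vs eqs by force
  then have "x a \<le> x d"
    using us eqs by auto
  then have "\<not> y' a \<le> y' d" if "bipartite_rep x y' U V" for y'
    using no_K34_leftmost_below[of x y' a b c d e f g] that us vs eqs by auto
  \<comment> \<open>Conjugating the reflection by the swap negates \<open>y\<close> and keeps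
    \<open>x\<close>, so the same sorted lists serve for both vertical orders of \<open>a\<close>
    and \<open>d\<close>.\<close>
  from this[OF rep] this[OF bipartite_rep_swap[OF bipartite_rep_reflect[OF bipartite_rep_swap[OF rep]]]]
  show False
    by simp
qed

lemma no_K44:
  assumes rep: "bipartite_rep x y U V" and "card U = 4" and "card V = 4"
  shows False
proof -
  have first: "\<exists>v\<in>V'. \<forall>u\<in>U'. x v < x u"
    if K44: "bipartite_rep x y U' V'" "card U' = 4" "card V' = 4" for U' V'
  proof -
    have "finite U'" "U' \<noteq> {}"
      using K44 by (auto simp: card_ge_0_finite)
    then obtain u where u: "u \<in> U'" "\<And>u'. u' \<in> U' \<Longrightarrow> x u \<le> x u'"
      using ex_min_if_finite[of "x ` U'"] by (force simp: not_less)
    \<comment> \<open>The three vertices kept from \<open>U'\<close> must include its leftmost one,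
      so that a square to the left of \<open>W\<close> is to the left of all of
      \<open>U'\<close>.\<close>
    have "3 \<le> card U'" "card {u} \<le> 3" "{u} \<subseteq> U'"
      using K44 u by auto
    then obtain W where W: "{u} \<subseteq> W" "W \<subseteq> U'" "card W = 3"
      using exists_subset_between[of "{u}" 3 U'] \<open>finite U'\<close> by auto
    then obtain v where "v \<in> V'" "x v < x u"
      using K34_leftmost[OF bipartite_rep_mono[OF K44(1) W(2) order_refl]] K44 W by auto
    then show ?thesis
      using u by force
  qed
  \<comment> \<open>Both parts would contain a square strictly to the left of the entire other
    part.\<close>
  show False
    using first[OF rep] first[OF bipartite_rep_commute[OF rep]] assms by force
qed

lemma K35_second_before:
  assumes rep: "bipartite_rep x y (set [a, b, c]) (set [d, e, f, g, h])"
    and "distinct [a, b, c]" and "distinct [d, e, f, g, h]"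
    and "x d \<le> x e" "x e \<le> x f" "x f \<le> x g" "x g \<le> x h"
  shows "x e < x a"
proof -
  have "bipartite_rep x y (set [a, b, c]) (set [e, f, g, h])"
    by (rule bipartite_rep_mono[OF rep]) auto
  moreover have "card (set [a, b, c]) = 3" "card (set [e, f, g, h]) = 4"
    using assms by (subst distinct_card; simp)+
  ultimately obtain v where "v \<in> set [e, f, g, h]" "x v < x a"
    using K34_leftmost[of x y "set [a, b, c]" "set [e, f, g, h]"] by auto
  then show ?thesis
    using assms by auto
qed

lemma K35_third_after:
  assumes rep: "bipartite_rep x y (set [a, b, c]) (set [d, e, f, g, h])"
    and dist: "distinct [a, b, c]" "distinct [d, e, f, g, h]"
    and ord: "x a \<le> x b" "x b \<le> x c" "x d \<le> x e" "x e \<le> x f" "x f \<le> x g" "x g \<le> x h"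
  shows "x b < x f"
proof (rule ccontr)
  assume "\<not> x b < x f"
  moreover have "bipartite_rep x y (set [a, b, c]) (set [d, e, f])"
    by (rule bipartite_rep_mono[OF rep]) auto
  moreover have "x e < x a"
    using K35_second_before[OF rep dist] ord by blast
  ultimately show False
    using no_K33_first_two_before[of x y a b c d e f] dist ord by simp
qed

lemma no_K35:
  assumes rep: "bipartite_rep x y U V" and "card U = 3" and "card V = 5"
  shows False
proof -
  have "finite U" "finite V"
    using assms by (simp_all add: card_ge_0_finite)
  then obtain us vs where us: "set us = U" "distinct us" "sorted (map x us)"
    and vs: "set vs = V" "distinct vs" "sorted (map x vs)"
    using ex_sorted_map_enumeration by metis
  have "length us = 3" "length vs = 5"
    using assms us vs distinct_card by metis+
  then obtain a b c d e f g h where eqs: "us = [a, b, c]" "vs = [d, e, f, g, h]"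
    by (auto simp: numeral_eq_Suc length_Suc_conv)
  have rep': "bipartite_rep x y (set [a, b, c]) (set [d, e, f, g, h])"
    using rep us vs eqs by simp
  then have "x b < x f"
    by (rule K35_third_after) (use us vs eqs in auto)
  \<comment> \<open>Reflection reverses both orders but fixes the middle positions of
    \<open>b\<close> and \<open>f\<close>.\<close>
  moreover have "bipartite_rep (\<lambda>v. - x v) y (set [c, b, a]) (set [h, g, f, e, d])"
    using bipartite_rep_reflect[OF rep'] by (simp add: insert_commute)
  then have "- x b < - x f"
    by (rule K35_third_after) (use us vs eqs in auto)
  ultimately show False
    by simp
qed

section \<open>From squares to inequalities\<close>

text \<open>Abstracting the line as \<open>l\<close>, with \<open>p\<close> its fixed coordinate,
  covers both directions; horizontal lines are obtained by exchanging \<open>x\<close> and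
  \<open>y\<close>.\<close>

lemma line_of_sight_if_visible_along:
  assumes vis: "visible_along l P S u w" and "u \<in> P" and "w \<in> P" and "u \<noteq> w"
    and apart: "pairwise (apart x y) P"
    and mem: "\<And>v t. v \<in> P \<Longrightarrow> l t \<in> S v \<longleftrightarrow> x v \<le> p \<and> p \<le> x v + 1 \<and> y v \<le> t \<and> t \<le> y v + 1"
    and mem_interior: "\<And>v t. v \<in> P \<Longrightarrow>
      l t \<in> interior (S v) \<longleftrightarrow> x v < p \<and> p < x v + 1 \<and> y v < t \<and> t < y v + 1"
  shows "line_of_sight x y P u w p"
proof -
  have on_line: "x u < p" "p < x u + 1" "x w < p" "p < x w + 1"
    using vis mem_interior \<open>u \<in> P\<close> \<open>w \<in> P\<close> unfolding visible_along_def by blast+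
  have stacked: "y i + 1 \<le> y j"
    if "i \<in> P" "j \<in> P" "y i < y j" "x i < p" "p < x i + 1" "x j < p" "p < x j + 1" for i j
    using pairwiseD[OF apart, of i j] that unfolding apart_def by fastforce
  have "p \<le> x k \<or> x k + 1 \<le> p \<or> y k \<le> y u \<and> y k \<le> y w \<or> y u \<le> y k \<and> y w \<le> y k"
    if "k \<in> P" for k
  proof (rule ccontr)
    assume "\<not> ?thesis"
    then have k: "x k < p" "p < x k + 1" and
      between: "y u < y k \<and> y k < y w \<or> y w < y k \<and> y k < y u"
      by auto
    have "y u + 1 \<le> y k \<and> y k + 1 \<le> y w \<or> y w + 1 \<le> y k \<and> y k + 1 \<le> y u"
      using between stacked[OF \<open>u \<in> P\<close> that] stacked[OF that \<open>w \<in> P\<close>]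
        stacked[OF \<open>w \<in> P\<close> that] stacked[OF that \<open>u \<in> P\<close>] on_line k by blast
    \<comment> \<open>The squares on the line are stacked, so all of \<open>S k\<close> on it lies
      between \<open>S u\<close> and \<open>S w\<close>; the midpoint is an interior point of
      \<open>S k\<close> there.\<close>
    then have "l (y k + 1 / 2) \<in> line_between l (S u) (S w)"
      unfolding line_between_def using mem \<open>u \<in> P\<close> \<open>w \<in> P\<close> by (intro imageI) fastforce
    moreover have "l (y k + 1 / 2) \<in> interior (S k)"
      using mem_interior that k by simp
    moreover have "k \<in> P - {u, w}"
      using that between by auto
    ultimately show False
      using vis unfolding visible_along_def by blast
  qed
  then show ?thesis
    using on_line unfolding line_of_sight_def by blast
qed

lemma bipartite_rep_corners:
  assumes "weak_unit_rect_visibility_rep G S"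
    and verts: "verts G = U \<union> V" and "U \<inter> V = {}"
    and arcs: "\<And>u v. u \<in> U \<Longrightarrow> v \<in> V \<Longrightarrow> u \<rightarrow>\<^bsub>G\<^esub> v"
  obtains x y where "bipartite_rep x y U V"
proof -
  have squares: "\<forall>v\<in>U \<union> V. \<exists>a b. S v = {a..a + 1} \<times> {b..b + 1}"
    and disjoint: "\<And>v w. v \<in> U \<union> V \<Longrightarrow> w \<in> U \<union> V \<Longrightarrow> v \<noteq> w \<Longrightarrow>
      interior (S v) \<inter> interior (S w) = {}"
    and bands: "\<And>u v. u \<in> U \<Longrightarrow> v \<in> V \<Longrightarrow>
      horizontal_band (U \<union> V) S u v \<or> vertical_band (U \<union> V) S u v"
    using assms unfolding weak_unit_rect_visibility_rep_def unit_square_def by auto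
  obtain x y where S: "\<And>v. v \<in> U \<union> V \<Longrightarrow> S v = {x v..x v + 1} \<times> {y v..y v + 1}"
    using squares by metis
  have int: "interior (S v) = {x v<..<x v + 1} \<times> {y v<..<y v + 1}" if "v \<in> U \<union> V" for v
    using S[OF that] by (simp add: interior_Times)
  have mem: "(s, t) \<in> S v \<longleftrightarrow> x v \<le> s \<and> s \<le> x v + 1 \<and> y v \<le> t \<and> t \<le> y v + 1"
    if "v \<in> U \<union> V" for v s t
    using S[OF that] by auto
  have mem_interior:
    "(s, t) \<in> interior (S v) \<longleftrightarrow> x v < s \<and> s < x v + 1 \<and> y v < t \<and> t < y v + 1"
    if "v \<in> U \<union> V" for v s t
    using int[OF that] by auto
  have apart_xy: "pairwise (apart x y) (U \<union> V)"
  proof (rule pairwiseI, rule ccontr)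
    fix i j assume ij: "i \<in> U \<union> V" "j \<in> U \<union> V" "i \<noteq> j" "\<not> apart x y i j"
    \<comment> \<open>The midpoint of the two centers: corners differing by less than 1 in each
      coordinate put it at distance less than 1/2 from both centers in each coordinate.\<close>
    then have "((x i + x j + 1) / 2, (y i + y j + 1) / 2) \<in> interior (S i) \<inter> interior (S j)"
      unfolding int[OF ij(1)] int[OF ij(2)] apart_def by auto
    then show False
      using disjoint ij by blast
  qed
  then have apart_yx: "pairwise (apart y x) (U \<union> V)"
    unfolding pairwise_def apart_def by blast
  have "\<exists>p. line_of_sight x y (U \<union> V) u v p \<or> line_of_sight y x (U \<union> V) u v p"
    if uv: "u \<in> U" "v \<in> V" for u v
    using bands[OF that]
  proof
    \<comment> \<open>One line from each band suffices; the middle one is chosen.\<close>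
    have mid: "(c + d) / 2 \<in> {c<..<d}" if "c < d" for c d :: real
      using that by simp
    have ne: "u \<in> U \<union> V" "v \<in> U \<union> V" "u \<noteq> v"
      using uv \<open>U \<inter> V = {}\<close> by auto
    {
      assume "horizontal_band (U \<union> V) S u v"
      then obtain p where "visible_along (\<lambda>t. (t, p)) (U \<union> V) S u v"
        unfolding horizontal_band_def using mid by blast
      then have "line_of_sight y x (U \<union> V) u v p"
        by (rule line_of_sight_if_visible_along[OF _ ne apart_yx]) (auto simp: mem mem_interior)
      then show ?thesis
        by blast
    next
      assume "vertical_band (U \<union> V) S u v"
      then obtain p where "visible_along (\<lambda>t. (p, t)) (U \<union> V) S u v"
        unfolding vertical_band_def using mid by blast
      then have "line_of_sight x y (U \<union> V) u v p"
        by (rule line_of_sight_if_visible_along[OF _ ne apart_xy]) (auto simp: mem mem_interior)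
      then show ?thesis
        by blast
    }
  qed
  then show ?thesis
    using that apart_xy \<open>U \<inter> V = {}\<close> unfolding bipartite_rep_def by blast
qed

theorem theorem5p5:
  fixes m n :: nat and G :: "('a, 'b) pre_digraph"
  assumes "0 < m" and "m \<le> n"
    and "(4 \<le> m \<and> 4 \<le> n) \<or> (3 \<le> m \<and> 5 \<le> n)"
    and "K\<^bsub>m,n\<^esub> G"
  shows "\<not> weak_unit_rect_visibility_graph G"
proof
  assume "weak_unit_rect_visibility_graph G"
  then obtain S where S: "weak_unit_rect_visibility_rep G S"
    unfolding weak_unit_rect_visibility_graph_def by blast
  obtain U V where UV: "verts G = U \<union> V" "U \<inter> V = {}" "card U = m" "card V = n"
    "arcs_ends G = U \<times> V \<union> V \<times> U"
    using assms(4) unfolding complete_bipartite_digraph_def by blast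
  obtain x y where rep: "bipartite_rep x y U V"
    using bipartite_rep_corners[OF S UV(1,2)] UV(5) by auto
  have no: False if sub: "i \<le> m" "j \<le> n"
    "\<And>U' V'. bipartite_rep x y U' V' \<Longrightarrow> card U' = i \<Longrightarrow> card V' = j \<Longrightarrow> False" for i j
  proof -
    obtain U' where U': "U' \<subseteq> U" "card U' = i"
      by (rule obtain_subset_with_card_n[of i U]) (use sub(1) UV(3) in auto)
    obtain V' where V': "V' \<subseteq> V" "card V' = j"
      by (rule obtain_subset_with_card_n[of j V]) (use sub(2) UV(4) in auto)
    show False
      using sub(3)[OF bipartite_rep_mono[OF rep U'(1) V'(1)] U'(2) V'(2)] .
  qed
  show False
    using assms(3)
  proof
    assume "4 \<le> m \<and> 4 \<le> n"
    then show False
      using no[of 4 4] no_K44 by blast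
  next
    assume "3 \<le> m \<and> 5 \<le> n"
    then show False
      using no[of 3 5] no_K35 by blast
  qed
qed

end
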